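(* Let $A:L^1(\Omega)\to L^\infty(\Gamma)$, $f$, $R$, $H_f$, $u^\dagger$ and $u_\alpha$ ($\alpha>0$) be as in the context. Assume that the following source condition holds: there exist $p^\dagger\in L^\infty(\Gamma)$ and $v^\dagger\in L^1(\Omega)$ such that $$A^*p^\dagger\in\partial R(u^\dagger)\quad\text{and}\quad f p^\dagger=Av^\dagger .$$ Assume that $Au_\alpha\in E$ for any $\alpha>0$, and that there exists a constant $m>0$ such that $m\le\inf\{\operatorname{ess\,inf}Au_\alpha:\alpha>0,\ \alpha\text{ sufficiently small}\}$. Then, for all sufficiently small $\alpha>0$, $$D_R(u_\alpha,u^\dagger)\le D_R(u^\dagger-\alpha v^\dagger,u^\dagger)+O(\alpha^3).$$
   Context: $\Omega,\Gamma\subset\mathbb{R}^2$ are bounded measurable sets. $A:L^1(\Omega)\to L^\infty(\Gamma)$ is linear, compact and ill-posed (i.e. the equation $Au=f$ is ill-posed). The data $f\in L^\infty(\Gamma)$ satisfy $c_1\le f(t)\le c_2$ for a.e. $t\in\Gamma$, for some constants $c_1,c_2>0$. The data fidelity is the Kullback-Leibler functional $H_f:L^\infty(\Gamma)\to[0,+\infty]$, $H_f(z)=\int_\Gamma\varphi_f(t,z(t))\,dt$ if $\varphi_f(\cdot,z(\cdot))\in L^1(\Gamma)$ and $H_f(z)=+\infty$ otherwise, where $\varphi_f(t,\tau)=f(t)\ln\frac{f(t)}{\tau}-f(t)+\tau$ for $\tau>0$ and $\varphi_f(t,\tau)=+\infty$ for $\tau\le0$. $R:L^1(\Omega)\to\mathbb{R}\cup\{+\infty\}$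 is proper, convex and lower semicontinuous. $u^\dagger$ is an $R$-minimizing solution, i.e. $u^\dagger\in\operatorname{arg\,min}\{R(u):Au=f\}$. For each $\alpha>0$ it is assumed that a minimizer $u_\alpha$ of $\frac1\alpha H_f(Au)+R(u)$ over $u\in L^1(\Omega)$ exists, and that there is $u_0\in\operatorname{dom}(H_f\circ A)\cap\operatorname{dom}R$ such that $H_f$ is continuous at $Au_0$. $E=\{v\in L^1(\Gamma):0<\operatorname{ess\,inf}v\le\operatorname{ess\,sup}v<+\infty\}$. An element $p\in L^\infty(\Gamma)$ is regarded as the element $z\mapsto\int_\Gamma p z\,dt$ of $(L^\infty(\Gamma))^*$, so that $A^*p\in L^\infty(\Omega)$ makes sense. Products and quotients of functions are pointwise. $D_R(u,u^\dagger)=R(u)-R(u^\dagger)-\langle A^*p^\dagger,u-u^\dagger\rangle$ is the Bregman distance with respect to $R$ and the subgradient $A^*p^\dagger\in\partial R(u^\dagger)$. $O(\alpha^3)$ is understood as $\alpha\to0$. *)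

theory Defs
  imports
    "HOL-Analysis.Analysis"
    "HOL-Probability.Essential_Supremum"
    "HOL-Library.Landau_Symbols"
begin

text \<open>
  Elements of the Lebesgue spaces over a measure space are represented by functions, and equality of
  elements is equality almost everywhere.  Maps between such spaces are maps between functions that
  are required to respect this equality; only their values on the relevant function spaces matter.
\<close>

definition L1 :: "'a measure \<Rightarrow> ('a \<Rightarrow> real) set" where
  "L1 M = {u. integrable M u}"

definition L1_norm :: "'a measure \<Rightarrow> ('a \<Rightarrow> real) \<Rightarrow> real" where
  "L1_norm M u = (\<integral>x. \<bar>u x\<bar> \<partial>M)"

definition Linf :: "'a measure \<Rightarrow> ('a \<Rightarrow> real) set" where
  "Linf M = {z \<in> borel_measurable M. esssup M (\<lambda>x. ennreal \<bar>z x\<bar>) < \<infinity>}"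

definition Linf_norm :: "'a measure \<Rightarrow> ('a \<Rightarrow> real) \<Rightarrow> real" where
  "Linf_norm M z = enn2real (esssup M (\<lambda>x. ennreal \<bar>z x\<bar>))"

definition essinf :: "'a measure \<Rightarrow> ('a \<Rightarrow> ereal) \<Rightarrow> ereal" where
  "essinf M g = - esssup M (\<lambda>x. - g x)"

definition ae_eq :: "'a measure \<Rightarrow> ('a \<Rightarrow> real) \<Rightarrow> ('a \<Rightarrow> real) \<Rightarrow> bool" where
  "ae_eq M u w \<longleftrightarrow> (AE x in M. u x = w x)"

definition linear_operator ::
  "'a measure \<Rightarrow> 'b measure \<Rightarrow> (('a \<Rightarrow> real) \<Rightarrow> ('b \<Rightarrow> real)) \<Rightarrow> bool" where
  "linear_operator M N A \<longleftrightarrow>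
     (\<forall>u\<in>L1 M. A u \<in> Linf N) \<and>
     (\<forall>u\<in>L1 M. \<forall>w\<in>L1 M. ae_eq M u w \<longrightarrow> ae_eq N (A u) (A w)) \<and>
     (\<forall>u\<in>L1 M. \<forall>w\<in>L1 M. ae_eq N (A (\<lambda>x. u x + w x)) (\<lambda>t. A u t + A w t)) \<and>
     (\<forall>c. \<forall>u\<in>L1 M. ae_eq N (A (\<lambda>x. c * u x)) (\<lambda>t. c * A u t))"

definition compact_operator ::
  "'a measure \<Rightarrow> 'b measure \<Rightarrow> (('a \<Rightarrow> real) \<Rightarrow> ('b \<Rightarrow> real)) \<Rightarrow> bool" where
  "compact_operator M N A \<longleftrightarrow>
     (\<forall>w :: nat \<Rightarrow> 'a \<Rightarrow> real. \<forall>C.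
        (\<forall>n. w n \<in> L1 M \<and> L1_norm M (w n) \<le> C) \<longrightarrow>
        (\<exists>z\<in>Linf N. \<exists>r :: nat \<Rightarrow> nat. strict_mono r \<and>
           (\<lambda>n. Linf_norm N (\<lambda>t. A (w (r n)) t - z t)) \<longlonglongrightarrow> 0))"

text \<open>
  Well-posedness of the equation \<open>A u = g\<close> in the sense of Hadamard: existence, uniqueness, and
  continuous dependence of the solution on the right-hand side.
\<close>

definition well_posed ::
  "'a measure \<Rightarrow> 'b measure \<Rightarrow> (('a \<Rightarrow> real) \<Rightarrow> ('b \<Rightarrow> real)) \<Rightarrow> bool" where
  "well_posed M N A \<longleftrightarrow>
     (\<forall>g\<in>Linf N. \<exists>u\<in>L1 M. ae_eq N (A u) g) \<and>
     (\<forall>u\<in>L1 M. \<forall>w\<in>L1 M. ae_eq N (A u) (A w) \<longrightarrow> ae_eq M u w) \<and>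
     (\<forall>u\<in>L1 M. \<forall>\<epsilon>>0. \<exists>\<delta>>0. \<forall>w\<in>L1 M.
        Linf_norm N (\<lambda>t. A w t - A u t) < \<delta> \<longrightarrow> L1_norm M (\<lambda>x. w x - u x) < \<epsilon>)"

definition ill_posed ::
  "'a measure \<Rightarrow> 'b measure \<Rightarrow> (('a \<Rightarrow> real) \<Rightarrow> ('b \<Rightarrow> real)) \<Rightarrow> bool" where
  "ill_posed M N A \<longleftrightarrow> \<not> well_posed M N A"


definition KL_integrand :: "('b \<Rightarrow> real) \<Rightarrow> 'b \<Rightarrow> real \<Rightarrow> ereal" where
  "KL_integrand f t \<tau> = (if \<tau> > 0 then ereal (f t * ln (f t / \<tau>) - f t + \<tau>) else \<infinity>)"

text \<open>
  The extended-real function \<open>t \<mapsto> KL_integrand f t (z t)\<close> belongs to \<open>L\<^sup>1\<close> iff it is finite almost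
  everywhere and its real part is integrable.
\<close>

definition KL :: "'b measure \<Rightarrow> ('b \<Rightarrow> real) \<Rightarrow> ('b \<Rightarrow> real) \<Rightarrow> ereal" where
  "KL N f z =
     (if (AE t in N. \<bar>KL_integrand f t (z t)\<bar> \<noteq> \<infinity>) \<and>
         integrable N (\<lambda>t. real_of_ereal (KL_integrand f t (z t)))
      then ereal (\<integral>t. real_of_ereal (KL_integrand f t (z t)) \<partial>N)
      else \<infinity>)"

definition Linf_continuous_at :: "'b measure \<Rightarrow> (('b \<Rightarrow> real) \<Rightarrow> ereal) \<Rightarrow> ('b \<Rightarrow> real) \<Rightarrow> bool" where
  "Linf_continuous_at N H z0 \<longleftrightarrow>
     (\<forall>U. open U \<and> H z0 \<in> U \<longrightarrow>
        (\<exists>\<delta>>0. \<forall>z\<in>Linf N. Linf_norm N (\<lambda>t. z t - z0 t) < \<delta> \<longrightarrow> H z \<in> U))"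

definition class_E :: "'b measure \<Rightarrow> ('b \<Rightarrow> real) set" where
  "class_E N = {v \<in> L1 N. 0 < essinf N (\<lambda>t. ereal (v t)) \<and>
     essinf N (\<lambda>t. ereal (v t)) \<le> esssup N (\<lambda>t. ereal (v t)) \<and>
     esssup N (\<lambda>t. ereal (v t)) < \<infinity>}"


text \<open>Functionals on \<open>L\<^sup>1\<close> with values in \<open>(-\<infinity>, \<infinity>]\<close>.\<close>

definition extended_functional :: "'a measure \<Rightarrow> (('a \<Rightarrow> real) \<Rightarrow> ereal) \<Rightarrow> bool" where
  "extended_functional M R \<longleftrightarrow>
     (\<forall>u\<in>L1 M. R u \<noteq> -\<infinity>) \<and>
     (\<forall>u\<in>L1 M. \<forall>w\<in>L1 M. ae_eq M u w \<longrightarrow> R u = R w)"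

definition dom_on :: "'a measure \<Rightarrow> (('a \<Rightarrow> real) \<Rightarrow> ereal) \<Rightarrow> ('a \<Rightarrow> real) set" where
  "dom_on M R = {u \<in> L1 M. R u < \<infinity>}"

definition proper_functional :: "'a measure \<Rightarrow> (('a \<Rightarrow> real) \<Rightarrow> ereal) \<Rightarrow> bool" where
  "proper_functional M R \<longleftrightarrow> extended_functional M R \<and> dom_on M R \<noteq> {}"

definition convex_functional :: "'a measure \<Rightarrow> (('a \<Rightarrow> real) \<Rightarrow> ereal) \<Rightarrow> bool" where
  "convex_functional M R \<longleftrightarrow>
     (\<forall>u\<in>L1 M. \<forall>w\<in>L1 M. \<forall>s::real. 0 < s \<and> s < 1 \<longrightarrow>
        R (\<lambda>x. (1 - s) * u x + s * w x) \<le> ereal (1 - s) * R u + ereal s * R w)"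

definition lsc_functional :: "'a measure \<Rightarrow> (('a \<Rightarrow> real) \<Rightarrow> ereal) \<Rightarrow> bool" where
  "lsc_functional M R \<longleftrightarrow>
     (\<forall>u\<in>L1 M. \<forall>c. c < R u \<longrightarrow>
        (\<exists>\<delta>>0. \<forall>w\<in>L1 M. L1_norm M (\<lambda>x. w x - u x) < \<delta> \<longrightarrow> c < R w))"


text \<open>
  The dual of \<open>L\<^sup>1\<close> is kept as a space of functionals; for finite measures it is identified with
  \<open>L\<^sup>\<infinity>\<close> through \<open>q \<mapsto> pairing M q\<close>.
\<close>

definition L1_dual :: "'a measure \<Rightarrow> (('a \<Rightarrow> real) \<Rightarrow> real) set" where
  "L1_dual M = {\<xi>.
     (\<forall>u\<in>L1 M. \<forall>w\<in>L1 M. \<xi> (\<lambda>x. u x + w x) = \<xi> u + \<xi> w) \<and>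
     (\<forall>c. \<forall>u\<in>L1 M. \<xi> (\<lambda>x. c * u x) = c * \<xi> u) \<and>
     (\<exists>C. \<forall>u\<in>L1 M. \<bar>\<xi> u\<bar> \<le> C * L1_norm M u)}"

definition pairing :: "'b measure \<Rightarrow> ('b \<Rightarrow> real) \<Rightarrow> ('b \<Rightarrow> real) \<Rightarrow> real" where
  "pairing N p z = (\<integral>t. p t * z t \<partial>N)"

text \<open>The Banach space adjoint of \<open>A\<close>, applied to the functional \<open>pairing N p\<close>.\<close>

definition adjoint_at ::
  "'b measure \<Rightarrow> (('a \<Rightarrow> real) \<Rightarrow> ('b \<Rightarrow> real)) \<Rightarrow> ('b \<Rightarrow> real) \<Rightarrow> ('a \<Rightarrow> real) \<Rightarrow> real" where
  "adjoint_at N A p = pairing N p \<circ> A"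

definition subdifferential ::
  "'a measure \<Rightarrow> (('a \<Rightarrow> real) \<Rightarrow> ereal) \<Rightarrow> ('a \<Rightarrow> real) \<Rightarrow> (('a \<Rightarrow> real) \<Rightarrow> real) set" where
  "subdifferential M R u =
     {\<xi> \<in> L1_dual M. \<forall>w\<in>L1 M. R u + ereal (\<xi> (\<lambda>x. w x - u x)) \<le> R w}"

definition bregman ::
  "(('a \<Rightarrow> real) \<Rightarrow> ereal) \<Rightarrow> (('a \<Rightarrow> real) \<Rightarrow> real) \<Rightarrow> ('a \<Rightarrow> real) \<Rightarrow> ('a \<Rightarrow> real) \<Rightarrow> ereal" where
  "bregman R \<xi> u w = R u - R w - ereal (\<xi> (\<lambda>x. u x - w x))"

definition R_minimizing_solution ::
  "'a measure \<Rightarrow> 'b measure \<Rightarrow> (('a \<Rightarrow> real) \<Rightarrow> ('b \<Rightarrow> real)) \<Rightarrow> (('a \<Rightarrow> real) \<Rightarrow> ereal) \<Rightarrow>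
     ('b \<Rightarrow> real) \<Rightarrow> ('a \<Rightarrow> real) \<Rightarrow> bool" where
  "R_minimizing_solution M N A R f u \<longleftrightarrow>
     u \<in> L1 M \<and> ae_eq N (A u) f \<and> (\<forall>w\<in>L1 M. ae_eq N (A w) f \<longrightarrow> R u \<le> R w)"

definition regularized_minimizer ::
  "'a measure \<Rightarrow> 'b measure \<Rightarrow> (('a \<Rightarrow> real) \<Rightarrow> ('b \<Rightarrow> real)) \<Rightarrow> (('a \<Rightarrow> real) \<Rightarrow> ereal) \<Rightarrow>
     ('b \<Rightarrow> real) \<Rightarrow> real \<Rightarrow> ('a \<Rightarrow> real) \<Rightarrow> bool" where
  "regularized_minimizer M N A R f \<alpha> u \<longleftrightarrow>
     u \<in> L1 M \<and>
     (\<forall>w\<in>L1 M. ereal (1 / \<alpha>) * KL N f (A u) + R u \<le> ereal (1 / \<alpha>) * KL N f (A w) + R w)"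

end

theory Submission
  imports Defs
begin

text \<open>
  The estimate comes from testing the minimality of \<open>u \<alpha>\<close> against \<open>w = udag - \<alpha> vdag\<close>.  Write
  \<open>\<xi> = A\<^sup>* pdag\<close>.  Since \<open>R (u \<alpha>) - R w \<le> (KL (A w) - KL (A (u \<alpha>))) / \<alpha>\<close>, the difference of the
  two Bregman distances is at most \<open>1/\<alpha>\<close> times the difference of the values of
  \<open>z \<mapsto> KL z + \<alpha> \<langle>pdag, z\<rangle>\<close> at \<open>A w\<close> and at \<open>A (u \<alpha>)\<close> (\<open>bregman_le_from_tilted_fidelity\<close>).

  This tilted functional is an integral, and its integrand can be minimized pointwise: with
  \<open>s = \<alpha> pdag t\<close>, the map \<open>\<tau> \<mapsto> f ln (f/\<tau>) - f + \<tau> + s \<tau>\<close> has the minimizer \<open>f / (1 + s)\<close> and the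
  minimum \<open>f ln (1 + s)\<close>.  By the source condition, \<open>A w = f (1 - s)\<close>.  This is the first-order
  expansion of the minimizer, so its distance to the minimizer is \<open>O(s\<^sup>2)\<close>; near a minimum the excess
  over the minimal value is quadratic in the distance, hence \<open>O(s\<^sup>4)\<close>.  Explicitly, the excess is
  \<open>f\<close> times \<open>- ln (1 - s) - s\<^sup>2 - ln (1 + s) = - (ln (1 - s\<^sup>2) + s\<^sup>2)\<close>, which is at most
  \<open>2 s\<^sup>4\<close> for \<open>\<bar>s\<bar> \<le> 1/2\<close> (\<open>KL_tilted_near_minimal\<close>).  Since \<open>pdag\<close> is essentially bounded, this
  holds almost everywhere on \<open>\<Gamma>\<close> once \<open>\<alpha>\<close> is small; after integration and division by \<open>\<alpha>\<close> there
  remains \<open>2 \<alpha>\<^sup>3\<close> times the integral of \<open>f pdag\<^sup>4\<close>.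
\<close>

section \<open>Essentially bounded functions\<close>

lemma Linf_AE_bounded:
  assumes "z \<in> Linf N"
  shows "\<exists>C>0. AE t in N. \<bar>z t\<bar> \<le> C"
proof -
  let ?e = "esssup N (\<lambda>x. ennreal \<bar>z x\<bar>)"
  have "z \<in> borel_measurable N" and fin: "?e < \<infinity>"
    using assms by (auto simp: Linf_def)
  then have "AE t in N. ennreal \<bar>z t\<bar> \<le> ?e"
    by (intro esssup_AE)
  then have "AE t in N. \<bar>z t\<bar> \<le> enn2real ?e + 1"
  proof eventually_elim
    case (elim t)
    then have "\<bar>z t\<bar> \<le> enn2real ?e"
      using enn2real_mono[OF elim] fin by simp
    then show ?case
      by simp
  qed
  moreover have "enn2real ?e + 1 > 0"
    by (simp add: add_nonneg_pos)
  ultimately show ?thesis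
    by blast
qed

lemma Linf_measurable: "z \<in> Linf N \<Longrightarrow> z \<in> borel_measurable N"
  by (simp add: Linf_def)

lemma integrable_Linf_mult:
  assumes "finite_measure N" and "p \<in> Linf N" and "z \<in> Linf N"
  shows "integrable N (\<lambda>t. p t * z t)"
proof -
  interpret finite_measure N by fact
  obtain C where "C > 0" and C: "AE t in N. \<bar>p t\<bar> \<le> C"
    using Linf_AE_bounded[OF assms(2)] by blast
  obtain D where D: "AE t in N. \<bar>z t\<bar> \<le> D"
    using Linf_AE_bounded[OF assms(3)] by blast
  have "AE t in N. norm (p t * z t) \<le> C * D"
    using C D
  proof eventually_elim
    case (elim t)
    then show ?case
      using \<open>C > 0\<close> by (simp add: abs_mult mult_mono)
  qed
  then show ?thesis
    using assms(2,3)[THEN Linf_measurable] by (intro integrable_const_bound) auto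
qed

section \<open>The Kullback-Leibler integrand with a linear tilt\<close>

text \<open>The inequality \<open>ln x \<le> x - 1\<close> at \<open>x = \<tau> (1 + s) / f\<close>; equality holds at \<open>\<tau> = f / (1 + s)\<close>.\<close>

lemma KL_tilted_lower_bound:
  fixes f \<tau> s :: real
  assumes "f > 0" and "\<tau> > 0" and "1 + s > 0"
  shows "f * ln (1 + s) \<le> f * ln (f / \<tau>) - f + \<tau> + s * \<tau>"
proof -
  have "f * ln (\<tau> * (1 + s) / f) \<le> f * (\<tau> * (1 + s) / f - 1)"
    using assms by (intro mult_left_mono ln_le_minus_one) auto
  moreover have "ln (\<tau> * (1 + s) / f) = ln (1 + s) - ln (f / \<tau>)"
    using assms by (simp add: ln_mult ln_div)
  moreover have "f * (\<tau> * (1 + s) / f - 1) = \<tau> + s * \<tau> - f"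
    using assms(1) by (simp add: field_simps)
  ultimately have "f * (ln (1 + s) - ln (f / \<tau>)) \<le> \<tau> + s * \<tau> - f"
    by (simp only:)
  then show ?thesis
    by (simp add: right_diff_distrib)
qed

text \<open>
  Divided by \<open>f\<close>, the left-hand side is \<open>- ln (1 - s) - s\<^sup>2\<close>, to be compared with the minimum
  \<open>ln (1 + s)\<close>.  The two logarithms combine to \<open>- ln (1 - s\<^sup>2)\<close>, whose leading term \<open>s\<^sup>2\<close> is removed by
  the \<open>- s\<^sup>2\<close> that comes from the tilt; hence the remainder has order four.
\<close>

lemma KL_tilted_near_minimal:
  fixes f \<tau> s :: real
  assumes "f > 0" and "\<tau> > 0" and "\<bar>s\<bar> \<le> 1/2"
  shows "f * ln (f / (f * (1 - s))) - f + f * (1 - s) + s * (f * (1 - s))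
    \<le> f * ln (f / \<tau>) - f + \<tau> + s * \<tau> + 2 * (f * s ^ 4)"
proof -
  have pos: "1 - s > 0" "1 + s > 0"
    using assms(3) by auto
  have "s\<^sup>2 \<le> (1/2)\<^sup>2"
    using assms(3) by (intro iffD1[OF abs_le_square_iff]) simp
  then have "\<bar>- s\<^sup>2\<bar> \<le> 1/2"
    by (simp add: power2_eq_square)
  then have "\<bar>ln (1 + - s\<^sup>2) - - s\<^sup>2\<bar> \<le> 2 * (- s\<^sup>2)\<^sup>2"
    by (rule abs_ln_one_plus_x_minus_x_bound)
  moreover have "1 + - s\<^sup>2 = (1 - s) * (1 + s)"
    by (simp add: algebra_simps power2_eq_square)
  moreover have "(- s\<^sup>2)\<^sup>2 = s ^ 4"
    by simp
  ultimately have "- ln (1 - s) - s\<^sup>2 \<le> ln (1 + s) + 2 * s ^ 4"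
    using pos by (simp add: ln_mult)
  then have "f * (- ln (1 - s) - s\<^sup>2) \<le> f * (ln (1 + s) + 2 * s ^ 4)"
    using assms(1) by (intro mult_left_mono) auto
  moreover have "ln (f / (f * (1 - s))) = - ln (1 - s)"
    using assms(1) pos by (simp add: ln_div)
  ultimately show ?thesis
    using KL_tilted_lower_bound[OF assms(1,2) pos(2)]
    by (simp add: algebra_simps power2_eq_square)
qed

section \<open>The tilted Kullback-Leibler functional\<close>

lemma KL_not_MInf [simp]: "KL N f z \<noteq> -\<infinity>"
  by (simp add: KL_def)

lemma KL_finiteD:
  assumes "KL N f z \<noteq> \<infinity>"
  shows "AE t in N. z t > 0"
    and "integrable N (\<lambda>t. real_of_ereal (KL_integrand f t (z t)))"
    and "KL N f z = ereal (\<integral>t. real_of_ereal (KL_integrand f t (z t)) \<partial>N)"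
proof -
  have "AE t in N. \<bar>KL_integrand f t (z t)\<bar> \<noteq> \<infinity>"
    using assms by (auto simp: KL_def split: if_splits)
  then show "AE t in N. z t > 0"
    by eventually_elim (auto simp: KL_integrand_def split: if_splits)
qed (use assms in \<open>auto simp: KL_def split: if_splits\<close>)

text \<open>
  With \<open>s = \<alpha> p t\<close>, the integrand equals \<open>- f (ln (1 - s) + s)\<close>, which is bounded because \<open>f\<close> is
  bounded and \<open>s\<close> stays away from \<open>1\<close>; bounded functions are integrable for a finite measure.
\<close>

lemma KL_finite_near_data:
  assumes "finite_measure N" and "f \<in> Linf N" and "AE t in N. f t > 0"
    and "y \<in> Linf N" and "AE t in N. y t = f t * (1 - \<alpha> * p t)"
    and "AE t in N. \<bar>\<alpha> * p t\<bar> \<le> 1/2"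
  shows "KL N f y \<noteq> \<infinity>"
proof -
  interpret finite_measure N by fact
  obtain C where C: "AE t in N. \<bar>f t\<bar> \<le> C"
    using Linf_AE_bounded[OF assms(2)] by blast
  have [measurable]: "f \<in> borel_measurable N" "y \<in> borel_measurable N"
    using assms(2,4) by (auto dest: Linf_measurable)
  have "AE t in N. y t > 0"
    using assms(3,5,6) by eventually_elim (auto intro!: mult_pos_pos)
  then have "AE t in N. \<bar>KL_integrand f t (y t)\<bar> \<noteq> \<infinity>"
    by eventually_elim (simp add: KL_integrand_def)
  moreover have bound: "AE t in N. norm (real_of_ereal (KL_integrand f t (y t))) \<le> C"
    using assms(3,5,6) C
  proof eventually_elim
    case (elim t)
    define s where "s = \<alpha> * p t"
    have s: "\<bar>s\<bar> \<le> 1/2"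
      using elim by (simp add: s_def)
    then have pos: "1 - s > 0"
      by auto
    have y: "y t = f t * (1 - s)"
      using elim by (simp add: s_def)
    have "\<bar>ln (1 + - s) - - s\<bar> \<le> 2 * (- s)\<^sup>2"
      using s by (intro abs_ln_one_plus_x_minus_x_bound) simp
    also have "\<dots> \<le> 2 * (1/2)\<^sup>2"
      using s by (intro mult_left_mono) (auto intro!: iffD1[OF abs_le_square_iff])
    finally have "\<bar>ln (1 - s) + s\<bar> \<le> 1"
      by (simp add: power2_eq_square)
    moreover have "ln (f t / y t) = - ln (1 - s)"
      using elim pos by (simp add: y ln_div)
    then have "real_of_ereal (KL_integrand f t (y t)) = - (f t * (ln (1 - s) + s))"
      using elim pos by (simp add: KL_integrand_def y algebra_simps)
    ultimately have "norm (real_of_ereal (KL_integrand f t (y t))) \<le> \<bar>f t\<bar> * 1"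
      by (simp add: abs_mult mult_left_le)
    then show ?case
      using elim by simp
  qed
  moreover have "(\<lambda>t. real_of_ereal (KL_integrand f t (y t))) \<in> borel_measurable N"
    unfolding KL_integrand_def by measurable
  then have "integrable N (\<lambda>t. real_of_ereal (KL_integrand f t (y t)))"
    by (rule integrable_const_bound[OF bound])
  ultimately show ?thesis
    by (simp add: KL_def)
qed

text \<open>
  The integrated form of \<open>KL_tilted_near_minimal\<close>: the point \<open>f (1 - \<alpha> p)\<close> minimizes the fidelity tilted
  by \<open>\<alpha> p\<close> up to an error of fourth order in \<open>\<alpha>\<close>.
\<close>

lemma KL_tilted_functional_near_minimal:
  assumes fin: "finite_measure N" and f: "f \<in> Linf N" and fpos: "AE t in N. f t > 0"
    and p: "p \<in> Linf N" and small: "AE t in N. \<bar>\<alpha> * p t\<bar> \<le> 1/2"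
    and y: "y \<in> Linf N" and y_eq: "AE t in N. y t = f t * (1 - \<alpha> * p t)"
    and z: "z \<in> Linf N"
  shows "KL N f y + ereal (\<alpha> * pairing N p y)
    \<le> KL N f z + ereal (\<alpha> * pairing N p z + 2 * \<alpha> ^ 4 * (\<integral>t. f t * p t ^ 4 \<partial>N))"
proof (cases "KL N f z = \<infinity>")
  case False
  let ?k = "\<lambda>z t. real_of_ereal (KL_integrand f t (z t))"
  note ky = KL_finiteD[OF KL_finite_near_data[OF fin f fpos y y_eq small]]
  note kz = KL_finiteD[OF False]
  note py = integrable_Linf_mult[OF fin p y] and pz = integrable_Linf_mult[OF fin p z]
  have fp: "integrable N (\<lambda>t. f t * p t ^ 4)"
  proof -
    interpret finite_measure N by fact
    obtain C where "C > 0" and C: "AE t in N. \<bar>f t\<bar> \<le> C"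
      using Linf_AE_bounded[OF f] by blast
    obtain D where D: "AE t in N. \<bar>p t\<bar> \<le> D"
      using Linf_AE_bounded[OF p] by blast
    have [measurable]: "f \<in> borel_measurable N" "p \<in> borel_measurable N"
      using f p by (auto dest: Linf_measurable)
    have "AE t in N. norm (f t * p t ^ 4) \<le> C * D ^ 4"
      using C D
    proof eventually_elim
      case (elim t)
      then have "\<bar>p t\<bar> ^ 4 \<le> D ^ 4"
        by (intro power_mono) auto
      then show ?case
        using elim \<open>C > 0\<close> by (auto simp: abs_mult power_abs intro!: mult_mono)
    qed
    then show ?thesis
      by (rule integrable_const_bound) measurable
  qed
  have "(\<integral>t. ?k y t + \<alpha> * (p t * y t) \<partial>N)
      \<le> (\<integral>t. ?k z t + \<alpha> * (p t * z t) + 2 * \<alpha> ^ 4 * (f t * p t ^ 4) \<partial>N)"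
  proof (rule integral_mono_AE)
    show "AE t in N. ?k y t + \<alpha> * (p t * y t)
        \<le> ?k z t + \<alpha> * (p t * z t) + 2 * \<alpha> ^ 4 * (f t * p t ^ 4)"
      using fpos ky(1) kz(1) small y_eq
    proof eventually_elim
      case (elim t)
      then show ?case
        using KL_tilted_near_minimal[of "f t" "z t" "\<alpha> * p t"]
        by (simp add: KL_integrand_def power_mult_distrib mult_ac)
    qed
  qed (use ky(2) kz(2) py pz fp in auto)
  then show ?thesis
    using ky(2) kz(2) py pz fp by (simp add: ky(3) kz(3) pairing_def)
qed simp

section \<open>Bregman distances of regularized minimizers\<close>

lemma L1_dual_diff:
  assumes "\<xi> \<in> L1_dual M" and "u \<in> L1 M" and "w \<in> L1 M"
  shows "\<xi> (\<lambda>x. u x - w x) = \<xi> u - \<xi> w"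
proof -
  have add: "\<forall>u\<in>L1 M. \<forall>w\<in>L1 M. \<xi> (\<lambda>x. u x + w x) = \<xi> u + \<xi> w"
    and scale: "\<forall>c. \<forall>u\<in>L1 M. \<xi> (\<lambda>x. c * u x) = c * \<xi> u"
    using assms(1) unfolding L1_dual_def by blast+
  have w': "(\<lambda>x. (-1) * w x) \<in> L1 M"
    using assms(3) by (simp add: L1_def)
  have "\<xi> (\<lambda>x. u x + (-1) * w x) = \<xi> u + \<xi> (\<lambda>x. (-1) * w x)"
    by (rule bspec[OF bspec[OF add assms(2)] w'])
  also have "\<xi> (\<lambda>x. (-1) * w x) = (-1) * \<xi> w"
    by (rule bspec[OF spec[OF scale] assms(3)])
  finally show ?thesis
    by simp
qed

lemma subdifferential_finite:
  assumes "proper_functional M R" and "\<xi> \<in> subdifferential M R u0" and "u0 \<in> L1 M"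
  shows "\<bar>R u0\<bar> \<noteq> \<infinity>"
proof -
  obtain w where "w \<in> L1 M" "R w < \<infinity>"
    using assms(1) by (auto simp: proper_functional_def dom_on_def)
  moreover then have "R u0 + ereal (\<xi> (\<lambda>x. w x - u0 x)) \<le> R w"
    using assms(2) by (auto simp: subdifferential_def)
  ultimately have "R u0 \<noteq> \<infinity>"
    by auto
  then show ?thesis
    using assms(1,3) by (auto simp: proper_functional_def extended_functional_def)
qed

text \<open>
  The reference point \<open>u0\<close> cancels from the difference of the two Bregman distances, which is
  \<open>R u - R w - (\<xi> u - \<xi> w)\<close>.  Minimality trades the first difference for a difference of fidelities.
\<close>

lemma bregman_le_from_tilted_fidelity:
  assumes R: "proper_functional M R" and \<xi>: "\<xi> \<in> subdifferential M R u0" and u0: "u0 \<in> L1 M"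
    and u: "regularized_minimizer M N A R f \<alpha> u" and "\<alpha> > 0"
    and w: "w \<in> L1 M" and fin: "KL N f (A w) \<noteq> \<infinity>"
    and le: "KL N f (A w) + ereal (\<alpha> * \<xi> w) \<le> KL N f (A u) + ereal (\<alpha> * \<xi> u + \<alpha> * \<delta>)"
  shows "bregman R \<xi> u u0 \<le> bregman R \<xi> w u0 + ereal \<delta>"
proof -
  obtain r0 where r0: "R u0 = ereal r0"
    using subdifferential_finite[OF R \<xi> u0] by auto
  obtain k where k: "KL N f (A w) = ereal k"
    using fin by (cases "KL N f (A w)") auto
  have uL: "u \<in> L1 M"
    and min: "ereal (1 / \<alpha>) * KL N f (A u) + R u \<le> ereal (1 / \<alpha>) * KL N f (A w) + R w"
    using u w by (auto simp: regularized_minimizer_def)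
  have dual: "\<xi> \<in> L1_dual M"
    using \<xi> by (simp add: subdifferential_def)
  have nm: "R u \<noteq> -\<infinity>" "R w \<noteq> -\<infinity>"
    using R uL w by (auto simp: proper_functional_def extended_functional_def)
  show ?thesis
  proof (cases "R w")
    case (real rw)
    obtain l where l: "KL N f (A u) = ereal l"
      using min nm \<open>\<alpha> > 0\<close> by (cases "KL N f (A u)"; cases "R u") (auto simp: k real)
    obtain ru where ru: "R u = ereal ru"
      using min nm by (cases "R u") (auto simp: k l real)
    have "1 / \<alpha> * l + ru \<le> 1 / \<alpha> * k + rw"
      using min by (simp add: k l real ru)
    moreover have "1 / \<alpha> * (k + \<alpha> * \<xi> w) \<le> 1 / \<alpha> * (l + \<alpha> * \<xi> u + \<alpha> * \<delta>)"
      using le \<open>\<alpha> > 0\<close> by (intro mult_left_mono) (auto simp: k l)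
    then have "1 / \<alpha> * k + \<xi> w \<le> 1 / \<alpha> * l + \<xi> u + \<delta>"
      using \<open>\<alpha> > 0\<close> by (simp add: add_divide_distrib)
    ultimately show ?thesis
      by (simp add: bregman_def r0 real ru L1_dual_diff[OF dual] uL w u0)
  next
    case PInf
    then show ?thesis
      by (simp add: bregman_def r0)
  qed (use nm in simp)
qed

section \<open>The higher-order convergence rate\<close>

text \<open>
  The source condition enters here: it turns the perturbation \<open>u0 - \<alpha> v\<close> of the solution into the
  perturbation \<open>f (1 - \<alpha> p)\<close> of the data.
\<close>

lemma operator_source_perturbation:
  assumes A: "linear_operator M N A" and "u0 \<in> L1 M" and "v \<in> L1 M"
    and "ae_eq N (A u0) f" and "ae_eq N (\<lambda>t. f t * p t) (A v)"
  shows "AE t in N. A (\<lambda>x. u0 x - \<alpha> * v x) t = f t * (1 - \<alpha> * p t)"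
proof -
  have v': "(\<lambda>x. (-\<alpha>) * v x) \<in> L1 M"
    using assms(3) by (simp add: L1_def)
  have add: "\<forall>u\<in>L1 M. \<forall>w\<in>L1 M. ae_eq N (A (\<lambda>x. u x + w x)) (\<lambda>t. A u t + A w t)"
    and scale: "\<forall>c. \<forall>u\<in>L1 M. ae_eq N (A (\<lambda>x. c * u x)) (\<lambda>t. c * A u t)"
    using A unfolding linear_operator_def by simp_all
  have "AE t in N. A (\<lambda>x. u0 x + (-\<alpha>) * v x) t = A u0 t + A (\<lambda>x. (-\<alpha>) * v x) t"
    using bspec[OF bspec[OF add assms(2)] v'] by (simp only: ae_eq_def)
  moreover have "AE t in N. A (\<lambda>x. (-\<alpha>) * v x) t = (-\<alpha>) * A v t"
    using bspec[OF spec[OF scale] assms(3)] by (simp only: ae_eq_def)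
  ultimately have "AE t in N. A (\<lambda>x. u0 x + (-\<alpha>) * v x) t = f t * (1 - \<alpha> * p t)"
    using assms(4,5) unfolding ae_eq_def
  proof eventually_elim
    case (elim t)
    have "A (\<lambda>x. u0 x + (-\<alpha>) * v x) t = f t + (-\<alpha>) * (f t * p t)"
      by (simp only: elim)
    then show ?case
      by (simp add: algebra_simps)
  qed
  then show ?thesis
    by simp
qed

theorem theorem5p2:
  fixes \<Omega> \<Gamma> :: "(real^2) set"
    and A :: "(real^2 \<Rightarrow> real) \<Rightarrow> (real^2 \<Rightarrow> real)"
    and f :: "real^2 \<Rightarrow> real"
    and R :: "(real^2 \<Rightarrow> real) \<Rightarrow> ereal"
    and udag vdag pdag :: "real^2 \<Rightarrow> real"
    and u :: "real \<Rightarrow> real^2 \<Rightarrow> real"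
    and c1 c2 :: real
  assumes "bounded \<Omega>" and "\<Omega> \<in> sets lebesgue"
    and "bounded \<Gamma>" and "\<Gamma> \<in> sets lebesgue"
    and "linear_operator (lebesgue_on \<Omega>) (lebesgue_on \<Gamma>) A"
    and "compact_operator (lebesgue_on \<Omega>) (lebesgue_on \<Gamma>) A"
    and "ill_posed (lebesgue_on \<Omega>) (lebesgue_on \<Gamma>) A"
    and "f \<in> Linf (lebesgue_on \<Gamma>)" and "c1 > 0" and "c2 > 0"
    and "AE t in lebesgue_on \<Gamma>. c1 \<le> f t \<and> f t \<le> c2"
    and "proper_functional (lebesgue_on \<Omega>) R"
    and "convex_functional (lebesgue_on \<Omega>) R"
    and "lsc_functional (lebesgue_on \<Omega>) R"
    and "R_minimizing_solution (lebesgue_on \<Omega>) (lebesgue_on \<Gamma>) A R f udag"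
    and "\<And>\<alpha>. \<alpha> > 0 \<Longrightarrow>
           regularized_minimizer (lebesgue_on \<Omega>) (lebesgue_on \<Gamma>) A R f \<alpha> (u \<alpha>)"
    and "\<exists>u0 \<in> dom_on (lebesgue_on \<Omega>) (KL (lebesgue_on \<Gamma>) f \<circ> A) \<inter> dom_on (lebesgue_on \<Omega>) R.
           Linf_continuous_at (lebesgue_on \<Gamma>) (KL (lebesgue_on \<Gamma>) f) (A u0)"
    and "pdag \<in> Linf (lebesgue_on \<Gamma>)" and "vdag \<in> L1 (lebesgue_on \<Omega>)"
    and "adjoint_at (lebesgue_on \<Gamma>) A pdag \<in> subdifferential (lebesgue_on \<Omega>) R udag"
    and "ae_eq (lebesgue_on \<Gamma>) (\<lambda>t. f t * pdag t) (A vdag)"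
    and "\<And>\<alpha>. \<alpha> > 0 \<Longrightarrow> A (u \<alpha>) \<in> class_E (lebesgue_on \<Gamma>)"
    and "\<exists>m>0. \<exists>\<alpha>0>0.
           ereal m \<le> (INF \<alpha>\<in>{0<..<\<alpha>0}. essinf (lebesgue_on \<Gamma>) (\<lambda>t. ereal (A (u \<alpha>) t)))"
  shows "\<exists>g :: real \<Rightarrow> real. g \<in> O[at_right 0](\<lambda>\<alpha>. \<alpha> ^ 3) \<and>
           (\<forall>\<^sub>F \<alpha> in at_right 0.
              bregman R (adjoint_at (lebesgue_on \<Gamma>) A pdag) (u \<alpha>) udag
                \<le> bregman R (adjoint_at (lebesgue_on \<Gamma>) A pdag) (\<lambda>x. udag x - \<alpha> * vdag x) udag
                   + ereal (g \<alpha>))"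
proof -
  let ?M = "lebesgue_on \<Omega>" and ?N = "lebesgue_on \<Gamma>"
  define \<xi> where "\<xi> = adjoint_at ?N A pdag"
  define w where "w \<alpha> = (\<lambda>x. udag x - \<alpha> * vdag x)" for \<alpha>
  define K where "K = 2 * (\<integral>t. f t * pdag t ^ 4 \<partial>?N)"
  have fin: "finite_measure ?N"
    using assms(3,4) bounded_set_imp_lmeasurable finite_measure_lebesgue_on by blast
  have fpos: "AE t in ?N. f t > 0"
    using assms(11) by eventually_elim (use assms(9) in auto)
  have udag: "udag \<in> L1 ?M" "ae_eq ?N (A udag) f"
    using assms(15) by (auto simp: R_minimizing_solution_def)
  have \<xi>: "\<xi> \<in> subdifferential ?M R udag"
    using assms(20) by (simp add: \<xi>_def)
  obtain P where "P > 0" and P: "AE t in ?N. \<bar>pdag t\<bar> \<le> P"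
    using Linf_AE_bounded[OF assms(18)] by blast
  have bound: "bregman R \<xi> (u \<alpha>) udag \<le> bregman R \<xi> (w \<alpha>) udag + ereal (K * \<alpha> ^ 3)"
    if "\<alpha> > 0" and "\<alpha> < 1 / (2 * P)" for \<alpha>
  proof (rule bregman_le_from_tilted_fidelity)
    have small: "AE t in ?N. \<bar>\<alpha> * pdag t\<bar> \<le> 1/2"
      using P
    proof eventually_elim
      case (elim t)
      then have "\<alpha> * \<bar>pdag t\<bar> \<le> 1 / (2 * P) * P"
        using that \<open>P > 0\<close> by (intro mult_mono) auto
      then show ?case
        using that \<open>P > 0\<close> by (simp add: abs_mult)
    qed
    show wL: "w \<alpha> \<in> L1 ?M"
      using udag(1) assms(19) by (simp add: w_def L1_def)
    have AL: "A x \<in> Linf ?N" if "x \<in> L1 ?M" for x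
      using assms(5) that by (auto simp: linear_operator_def)
    have Aw: "AE t in ?N. A (w \<alpha>) t = f t * (1 - \<alpha> * pdag t)"
      unfolding w_def
      by (rule operator_source_perturbation) (use assms(5,19,21) udag in simp_all)
    show "KL ?N f (A (w \<alpha>)) \<noteq> \<infinity>"
      by (rule KL_finite_near_data[OF fin assms(8) fpos AL[OF wL] Aw small])
    have "u \<alpha> \<in> L1 ?M"
      using assms(16)[OF that(1)] by (simp add: regularized_minimizer_def)
    then have "A (u \<alpha>) \<in> Linf ?N"
      by (rule AL)
    from KL_tilted_functional_near_minimal[OF fin assms(8) fpos assms(18) small AL[OF wL] Aw this]
    show "KL ?N f (A (w \<alpha>)) + ereal (\<alpha> * \<xi> (w \<alpha>))
        \<le> KL ?N f (A (u \<alpha>)) + ereal (\<alpha> * \<xi> (u \<alpha>) + \<alpha> * (K * \<alpha> ^ 3))"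
      by (simp add: \<xi>_def adjoint_at_def K_def power4_eq_xxxx power3_eq_cube mult_ac)
  qed (use assms(12) \<xi> udag(1) assms(16) that in auto)
  have "\<forall>\<^sub>F \<alpha> in at_right 0.
      bregman R \<xi> (u \<alpha>) udag \<le> bregman R \<xi> (w \<alpha>) udag + ereal (K * \<alpha> ^ 3)"
    unfolding eventually_at_right_field using bound \<open>P > 0\<close>
    by (intro exI[of _ "1 / (2 * P)"]) simp
  moreover have "(\<lambda>\<alpha>. K * \<alpha> ^ 3) \<in> O[at_right 0](\<lambda>\<alpha>::real. \<alpha> ^ 3)"
    by simp
  ultimately show ?thesis
    unfolding \<xi>_def w_def by (intro exI[of _ "\<lambda>\<alpha>. K * \<alpha> ^ 3"] conjI)
qed

end
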